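(* Let $\mathcal{G} = (V, D, \mathit{Con}, \mathit{Env}, \psi)$ be an LTL game and let $\mathcal{A}_\psi = (Q, \{q_0\}, \mathcal{T}, F)$ be a deterministic and complete Büchi automaton over $V$ with $L(\mathcal{A}_\psi)$ equal to the set of infinite sequences of $V$-states satisfying $\psi$. Let $\mathcal{G} \otimes \mathcal{A}_\psi = (V \cup \{q\}, D', \mathit{Con}', \mathit{Env}', \psi')$ be the product game, where $q$ is a fresh variable with $D'(q) = Q$ and $D'(x) = D(x)$ for $x \in V$, $$\mathit{Con}' = \mathit{Con} \wedge \bigvee_{(p,\delta,p') \in \mathcal{T}} (q = p \wedge \delta \wedge q' = p'),\qquad \mathit{Env}' = \mathit{Env} \wedge \bigvee_{(p,\delta,p') \in \mathcal{T}} (q = p \wedge \delta \wedge q' = p'),$$ (here $\delta$ is evaluated on the unprimed variables $V$), and $\psi' = \mathbf{G}\mathbf{F}\big(\bigvee_{p \in F} q = p\big)$. Let $W'$ be the winning region for Player $C$ in $\mathcal{G} \otimes \mathcal{A}_\psi$. Then the winning region for Player $C$ in $\mathcal{G}$ is $W = \{ s \mid (s, q_0) \in W' \}$. Furthermore, when $\mathcal{G}$ is finitely non-deterministic, given a finitely-representable memoryless strategy for $C$ in $\mathcal{G} \otimes \mathcal{A}_\psi$, one can construct a finitely-representable finite-memory strategy for $C$ in $\mathcal{G}$.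
   Context: Constraints over a set of variables $V$ are quantifier-free formulas of linear arithmetic (boolean combinations of atomic constraints $a_1x_1+\dots+a_nx_n \sim c$ with integer $a_i, c$ and $\sim \in \{<,\le,=,\ge,>\}$), interpreted over the reals. A $V$-state is a map $s: V \to \mathbb{R}$; a domain mapping $D$ assigns to each $x \in V$ a set $D(x) \subseteq \mathbb{R}$, and a $(V,D)$-state is a $V$-state with $s(x) \in D(x)$ for all $x$. For a set $X$ of variables, $X'$ denotes primed copies; a constraint over $V \cup V'$ is evaluated on a pair of states $(s,t)$ with $s$ interpreting $V$ and $t$ interpreting $V'$. $\mathrm{LTL}(V)$: formulas $\psi ::= \delta \mid \neg\psi \mid \psi\vee\psi \mid \mathbf{X}\psi \mid \psi\,\mathbf{U}\,\psi$ with $\delta$ an atomic constraint over $V$, interpreted over infinite sequences of $V$-states in the standard way ($\delta$ holds at position $i$ iff the $i$-th state satisfies $\delta$); $\mathbf{F}$, $\mathbf{G}$ are the usual derived operators. A Büchi automaton over $V$ is a tuple $(Q, I, \mathcal{T}, F)$ with $Q$ a finite set of states, $I \subseteq Q$ initial states, $\mathcal{T}$ a finite subset of $Q \times (\text{constraints over } V) \times Q$, and $F \subseteq Q$ final states. It induces the concrete relation $(p,s,p') \in \Delta_\mathcal{T}$ iff some $(p,\delta,p') \in \mathcal{T}$ has $s \models \delta$. A run on $s_0 s_1\cdots$ is $q_0 q_1 \cdots$ with $q_0 \in I$ and $(q_i,s_i,q_{i+1}) \in \Delta_\mathcal{T}$; it is accepting if it visits $F$ infinitely often, and the automaton accepts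 a sequence if some run on it is accepting. The automaton is deterministic if $I$ is a singleton and for each $p$ and $V$-state $s$ there is at most one $p'$ with $(p,s,p') \in \Delta_\mathcal{T}$; complete if there is at least one. An LTL game is $\mathcal{G} = (V, D, \mathit{Con}, \mathit{Env}, \psi)$ where $\mathit{Con}(V,V')$ and $\mathit{Env}(V,V')$ are constraints over $V \cup V'$ (the moves of Player $C$ (controller) and Player $E$ (environment)) and $\psi \in \mathrm{LTL}(V)$. Positions are $(V,D)$-states. A play from $s_0$ is a sequence $s_0 s_1 s_2 \cdots$ of $(V,D)$-states in which the players alternate, $C$ moving first: $(s_{2i}, s_{2i+1}) \models \mathit{Con}$ and $(s_{2i+1}, s_{2i+2}) \models \mathit{Env}$. A strategy for $C$ assigns to each odd-length finite play $w = s_0\cdots s_{2i}$ a nonempty set $\sigma(w)$ of states $t$ with $(s_{2i},t) \models \mathit{Con}$; a play is consistent with $\sigma$ if $s_{2i+1} \in \sigma(s_0\cdots s_{2i})$ for all $i$. A strategy is winning from $s$ if every play from $s$ consistent with it satisfies $\psi$; the winning region of $C$ is the set of states from which $C$ has a winning strategy. A strategy is memoryless if $\sigma(w)$ depends only on the last state of $w$, and finite-memory if it is computed by a finite-state strategy automaton reading the play. The game is finitely non-deterministic (FND) if $\mathit{Con} = \mathit{Con}_1 \vee \dots \vee \mathit{Con}_k$ for finitely many moves $\mathit{Con}_i$; a strategy is finitely representable if it is given by a strategy automaton with finitely many controller states, each labelled by a constraint on the current state and one of the moves $\mathit{Con}_i$ to be offered there. *)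

theory Defs
  imports Complex_Main "HOL-Library.FuncSet"
begin

section \<open>Linear-arithmetic constraints\<close>

datatype lrel = Lt | Le | Eq | Ge | Gt

fun lrel_holds :: "lrel \<Rightarrow> real \<Rightarrow> real \<Rightarrow> bool" where
  "lrel_holds Lt x y \<longleftrightarrow> x < y"
| "lrel_holds Le x y \<longleftrightarrow> x \<le> y"
| "lrel_holds Eq x y \<longleftrightarrow> x = y"
| "lrel_holds Ge x y \<longleftrightarrow> x \<ge> y"
| "lrel_holds Gt x y \<longleftrightarrow> x > y"

text \<open>The set functions of the datatypes below give the variables occurring in an atom, a
  constraint or an LTL formula; the map functions rename variables.\<close>

datatype (atom_vars: 'v) atom = Atom "(int \<times> 'v) list" lrel int

datatype (constr_vars: 'v) constr =
    CAtom "'v atom"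
  | CNot "'v constr"
  | CAnd "'v constr" "'v constr"
  | COr "'v constr" "'v constr"

type_synonym 'v state = "'v \<Rightarrow> real"

fun atom_sat :: "'v state \<Rightarrow> 'v atom \<Rightarrow> bool" where
  "atom_sat s (Atom ts r c) \<longleftrightarrow>
     lrel_holds r (\<Sum>(a, x)\<leftarrow>ts. real_of_int a * s x) (real_of_int c)"

fun sat :: "'v state \<Rightarrow> 'v constr \<Rightarrow> bool" where
  "sat s (CAtom a) \<longleftrightarrow> atom_sat s a"
| "sat s (CNot c) \<longleftrightarrow> \<not> sat s c"
| "sat s (CAnd c d) \<longleftrightarrow> sat s c \<and> sat s d"
| "sat s (COr c d) \<longleftrightarrow> sat s c \<or> sat s d"

text \<open>The atom \<open>x = p\<close>, and the false atom \<open>0 = 1\<close> used for empty disjunctions.\<close>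

definition eq_atom :: "'v \<Rightarrow> int \<Rightarrow> 'v atom" where
  "eq_atom x p = Atom [(1, x)] Eq p"

definition false_atom :: "'v atom" where
  "false_atom = Atom [] Eq 1"

text \<open>A disjunction over a finite set needs some enumeration of that set; which one is chosen is
  irrelevant semantically.\<close>

definition enum_list :: "'a set \<Rightarrow> 'a list" where
  "enum_list A = (SOME xs. set xs = A \<and> distinct xs)"

definition CDisj :: "('a \<Rightarrow> 'v constr) \<Rightarrow> 'a set \<Rightarrow> 'v constr" where
  "CDisj f A = foldr (\<lambda>a. COr (f a)) (enum_list A) (CAtom false_atom)"

datatype 'v pvar = Cur 'v | Nxt 'v

definition pvars :: "'v set \<Rightarrow> 'v pvar set" where
  "pvars V = Cur ` V \<union> Nxt ` V"

definition pair_sat :: "'v state \<Rightarrow> 'v state \<Rightarrow> 'v pvar constr \<Rightarrow> bool" where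
  "pair_sat s t c \<longleftrightarrow> sat (case_pvar s t) c"

text \<open>States are extensional functions, so that a \<open>V\<close>-state is determined by its values on \<open>V\<close>.\<close>

definition vstates :: "'v set \<Rightarrow> 'v state set" where
  "vstates V = (\<Pi>\<^sub>E x\<in>V. UNIV)"


section \<open>LTL\<close>

datatype (ltl_vars: 'v) ltl =
    LAtom "'v atom"
  | LNot "'v ltl"
  | LOr "'v ltl" "'v ltl"
  | LNext "'v ltl"
  | LUntil "'v ltl" "'v ltl"

fun ltl_sat_at :: "(nat \<Rightarrow> 'v state) \<Rightarrow> nat \<Rightarrow> 'v ltl \<Rightarrow> bool" where
  "ltl_sat_at \<rho> i (LAtom a) \<longleftrightarrow> atom_sat (\<rho> i) a"
| "ltl_sat_at \<rho> i (LNot \<phi>) \<longleftrightarrow> \<not> ltl_sat_at \<rho> i \<phi>"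
| "ltl_sat_at \<rho> i (LOr \<phi> \<chi>) \<longleftrightarrow> ltl_sat_at \<rho> i \<phi> \<or> ltl_sat_at \<rho> i \<chi>"
| "ltl_sat_at \<rho> i (LNext \<phi>) \<longleftrightarrow> ltl_sat_at \<rho> (Suc i) \<phi>"
| "ltl_sat_at \<rho> i (LUntil \<phi> \<chi>) \<longleftrightarrow>
     (\<exists>k\<ge>i. ltl_sat_at \<rho> k \<chi> \<and> (\<forall>j. i \<le> j \<and> j < k \<longrightarrow> ltl_sat_at \<rho> j \<phi>))"

definition ltl_sat :: "(nat \<Rightarrow> 'v state) \<Rightarrow> 'v ltl \<Rightarrow> bool" where
  "ltl_sat \<rho> \<phi> \<longleftrightarrow> ltl_sat_at \<rho> 0 \<phi>"

definition LF :: "'v ltl \<Rightarrow> 'v ltl" where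
  "LF \<phi> = LUntil (LNot (LAtom false_atom)) \<phi>"

definition LG :: "'v ltl \<Rightarrow> 'v ltl" where
  "LG \<phi> = LNot (LF (LNot \<phi>))"

definition LDisj :: "('a \<Rightarrow> 'v ltl) \<Rightarrow> 'a set \<Rightarrow> 'v ltl" where
  "LDisj f A = foldr (\<lambda>a. LOr (f a)) (enum_list A) (LAtom false_atom)"


section \<open>Buechi automata over \<open>V\<close>\<close>

record ('q, 'v) buchi =
  bstates :: "'q set"
  binit :: "'q set"
  btrans :: "('q \<times> 'v constr \<times> 'q) set"
  bfinal :: "'q set"

definition buchi_over :: "'v set \<Rightarrow> ('q, 'v) buchi \<Rightarrow> bool" where
  "buchi_over V A \<longleftrightarrow>
     finite (bstates A) \<and> binit A \<subseteq> bstates A \<and> bfinal A \<subseteq> bstates A \<and> finite (btrans A) \<and>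
     btrans A \<subseteq> bstates A \<times> {\<delta>. constr_vars \<delta> \<subseteq> V} \<times> bstates A"

definition step_rel :: "('q \<times> 'v constr \<times> 'q) set \<Rightarrow> ('q \<times> 'v state \<times> 'q) set" where
  "step_rel T = {(p, s, p'). \<exists>\<delta>. (p, \<delta>, p') \<in> T \<and> sat s \<delta>}"

definition buchi_run :: "('q, 'v) buchi \<Rightarrow> (nat \<Rightarrow> 'v state) \<Rightarrow> (nat \<Rightarrow> 'q) \<Rightarrow> bool" where
  "buchi_run A \<rho> r \<longleftrightarrow> r 0 \<in> binit A \<and> (\<forall>i. (r i, \<rho> i, r (Suc i)) \<in> step_rel (btrans A))"

definition buchi_accepts :: "('q, 'v) buchi \<Rightarrow> (nat \<Rightarrow> 'v state) \<Rightarrow> bool" where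
  "buchi_accepts A \<rho> \<longleftrightarrow> (\<exists>r. buchi_run A \<rho> r \<and> infinite {i. r i \<in> bfinal A})"

definition buchi_lang :: "'v set \<Rightarrow> ('q, 'v) buchi \<Rightarrow> (nat \<Rightarrow> 'v state) set" where
  "buchi_lang V A = {\<rho>. (\<forall>i. \<rho> i \<in> vstates V) \<and> buchi_accepts A \<rho>}"

definition buchi_deterministic :: "'v set \<Rightarrow> ('q, 'v) buchi \<Rightarrow> bool" where
  "buchi_deterministic V A \<longleftrightarrow>
     is_singleton (binit A) \<and>
     (\<forall>p\<in>bstates A. \<forall>s\<in>vstates V. \<forall>p1 p2.
        (p, s, p1) \<in> step_rel (btrans A) \<and> (p, s, p2) \<in> step_rel (btrans A) \<longrightarrow> p1 = p2)"

definition buchi_complete :: "'v set \<Rightarrow> ('q, 'v) buchi \<Rightarrow> bool" where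
  "buchi_complete V A \<longleftrightarrow>
     (\<forall>p\<in>bstates A. \<forall>s\<in>vstates V. \<exists>p'. (p, s, p') \<in> step_rel (btrans A))"


section \<open>LTL games\<close>

record 'v game =
  gvars :: "'v set"
  gdom :: "'v \<Rightarrow> real set"
  gcon :: "'v pvar constr"
  genv :: "'v pvar constr"
  gspec :: "'v ltl"

definition ltl_game :: "'v game \<Rightarrow> bool" where
  "ltl_game G \<longleftrightarrow>
     constr_vars (gcon G) \<subseteq> pvars (gvars G) \<and>
     constr_vars (genv G) \<subseteq> pvars (gvars G) \<and>
     ltl_vars (gspec G) \<subseteq> gvars G"

definition positions :: "'v game \<Rightarrow> 'v state set" where
  "positions G = Pi\<^sub>E (gvars G) (gdom G)"

definition legal :: "'v game \<Rightarrow> nat \<Rightarrow> 'v state \<Rightarrow> 'v state \<Rightarrow> bool" where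
  "legal G i s t \<longleftrightarrow> pair_sat s t (if even i then gcon G else genv G)"

definition play :: "'v game \<Rightarrow> (nat \<Rightarrow> 'v state) \<Rightarrow> bool" where
  "play G \<rho> \<longleftrightarrow> (\<forall>i. \<rho> i \<in> positions G) \<and> (\<forall>i. legal G i (\<rho> i) (\<rho> (Suc i)))"

definition fin_play :: "'v game \<Rightarrow> 'v state list \<Rightarrow> bool" where
  "fin_play G w \<longleftrightarrow>
     w \<noteq> [] \<and> set w \<subseteq> positions G \<and>
     (\<forall>i. Suc i < length w \<longrightarrow> legal G i (w ! i) (w ! Suc i))"

definition odd_play :: "'v game \<Rightarrow> 'v state list \<Rightarrow> bool" where
  "odd_play G w \<longleftrightarrow> fin_play G w \<and> odd (length w)"

text \<open>Strategies are total on lists of states; only their values on odd-length finite plays matter.\<close>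

type_synonym 'v strat = "'v state list \<Rightarrow> 'v state set"

definition strategy :: "'v game \<Rightarrow> 'v strat \<Rightarrow> bool" where
  "strategy G \<sigma> \<longleftrightarrow>
     (\<forall>w. odd_play G w \<longrightarrow>
        \<sigma> w \<noteq> {} \<and> \<sigma> w \<subseteq> {t \<in> positions G. pair_sat (last w) t (gcon G)})"

definition consistent :: "'v strat \<Rightarrow> (nat \<Rightarrow> 'v state) \<Rightarrow> bool" where
  "consistent \<sigma> \<rho> \<longleftrightarrow> (\<forall>i. \<rho> (2 * i + 1) \<in> \<sigma> (map \<rho> [0..<2 * i + 1]))"

definition winning_from :: "'v game \<Rightarrow> 'v strat \<Rightarrow> 'v state \<Rightarrow> bool" where
  "winning_from G \<sigma> s \<longleftrightarrow>
     (\<forall>\<rho>. play G \<rho> \<and> \<rho> 0 = s \<and> consistent \<sigma> \<rho> \<longrightarrow> ltl_sat \<rho> (gspec G))"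

definition winning_region :: "'v game \<Rightarrow> 'v state set" where
  "winning_region G = {s \<in> positions G. \<exists>\<sigma>. strategy G \<sigma> \<and> winning_from G \<sigma> s}"

definition memoryless :: "'v game \<Rightarrow> 'v strat \<Rightarrow> bool" where
  "memoryless G \<sigma> \<longleftrightarrow>
     (\<forall>w w'. odd_play G w \<and> odd_play G w' \<and> last w = last w' \<longrightarrow> \<sigma> w = \<sigma> w')"

text \<open>A finite-memory strategy is computed by a finite automaton that reads the play so far and, in
  its current memory state and the current position, outputs the set of offered positions. Memory
  states are natural numbers without loss of generality.\<close>

definition finite_memory :: "'v game \<Rightarrow> 'v strat \<Rightarrow> bool" where
  "finite_memory G \<sigma> \<longleftrightarrow>
     (\<exists>(M :: nat set) m0 upd out.
        finite M \<and> m0 \<in> M \<and> (\<forall>m\<in>M. \<forall>s\<in>positions G. upd m s \<in> M) \<and>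
        (\<forall>w. odd_play G w \<longrightarrow> \<sigma> w = out (foldl upd m0 (butlast w)) (last w)))"

text \<open>The game is finitely non-deterministic with moves \<open>cs = [Con_1, ..., Con_k]\<close> if \<open>Con\<close> is their
  disjunction, up to equivalence of constraints.\<close>

definition fin_nondet :: "'v game \<Rightarrow> 'v pvar constr list \<Rightarrow> bool" where
  "fin_nondet G cs \<longleftrightarrow>
     (\<forall>c\<in>set cs. constr_vars c \<subseteq> pvars (gvars G)) \<and>
     (\<forall>s\<in>vstates (gvars G). \<forall>t\<in>vstates (gvars G).
        pair_sat s t (gcon G) \<longleftrightarrow> (\<exists>c\<in>set cs. pair_sat s t c))"

text \<open>Symbolic strategy automata. The controller state \<open>r\<close> is labelled with the constraint
  \<open>sacond r\<close> on the current position and with the index \<open>samove r\<close> of the move offered there.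
  The automaton alternates between controller and environment states while reading the play;
  transitions are guarded by constraints, as in a Buechi automaton.\<close>

record ('r, 'v) strat_aut =
  sactrl :: "'r set"
  saenv :: "'r set"
  sainit :: "'r set"
  satrans :: "('r \<times> 'v constr \<times> 'r) set"
  sacond :: "'r \<Rightarrow> 'v constr"
  samove :: "'r \<Rightarrow> nat"

definition strat_aut_over :: "'v set \<Rightarrow> nat \<Rightarrow> ('r, 'v) strat_aut \<Rightarrow> bool" where
  "strat_aut_over V k S \<longleftrightarrow>
     finite (sactrl S) \<and> finite (saenv S) \<and> sactrl S \<inter> saenv S = {} \<and>
     sainit S \<subseteq> sactrl S \<and> finite (satrans S) \<and>
     satrans S \<subseteq> (sactrl S \<times> {\<delta>. constr_vars \<delta> \<subseteq> V} \<times> saenv S) \<union>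
                (saenv S \<times> {\<delta>. constr_vars \<delta> \<subseteq> V} \<times> sactrl S) \<and>
     (\<forall>r\<in>sactrl S. constr_vars (sacond S r) \<subseteq> V \<and> samove S r < k)"

definition strat_aut_run :: "('r, 'v) strat_aut \<Rightarrow> 'v state list \<Rightarrow> 'r list \<Rightarrow> bool" where
  "strat_aut_run S w rs \<longleftrightarrow>
     length rs = length w \<and> rs \<noteq> [] \<and> hd rs \<in> sainit S \<and>
     (\<forall>i. Suc i < length w \<longrightarrow> (rs ! i, w ! i, rs ! Suc i) \<in> step_rel (satrans S)) \<and>
     (\<forall>i < length w. even i \<longrightarrow> sat (w ! i) (sacond S (rs ! i)))"

definition strat_aut_strategy ::
    "'v game \<Rightarrow> 'v pvar constr list \<Rightarrow> ('r, 'v) strat_aut \<Rightarrow> 'v strat" where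
  "strat_aut_strategy G cs S w =
     {t \<in> positions G. \<exists>rs. strat_aut_run S w rs \<and> pair_sat (last w) t (cs ! samove S (last rs))}"

definition finitely_representable :: "'v game \<Rightarrow> 'v pvar constr list \<Rightarrow> 'v strat \<Rightarrow> bool" where
  "finitely_representable G cs \<sigma> \<longleftrightarrow>
     (\<exists>S :: (nat, 'v) strat_aut. strat_aut_over (gvars G) (length cs) S \<and>
        (\<forall>w. odd_play G w \<longrightarrow> \<sigma> w = strat_aut_strategy G cs S w))"


section \<open>The product game\<close>

text \<open>Automaton states are integers, since they serve as values of the variable \<open>q\<close> and as
  constants in the constraints \<open>q = p\<close>.\<close>

definition trans_constr :: "'v \<Rightarrow> (int, 'v) buchi \<Rightarrow> 'v pvar constr" where
  "trans_constr q A =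
     CDisj (\<lambda>(p, \<delta>, p'). CAnd (CAtom (eq_atom (Cur q) p))
                            (CAnd (map_constr Cur \<delta>) (CAtom (eq_atom (Nxt q) p'))))
           (btrans A)"

definition product_move :: "'v \<Rightarrow> (int, 'v) buchi \<Rightarrow> 'v pvar constr \<Rightarrow> 'v pvar constr" where
  "product_move q A c = CAnd c (trans_constr q A)"

definition product_game :: "'v game \<Rightarrow> 'v \<Rightarrow> (int, 'v) buchi \<Rightarrow> 'v game" where
  "product_game G q A =
     \<lparr> gvars = insert q (gvars G),
       gdom = (gdom G)(q := real_of_int ` bstates A),
       gcon = product_move q A (gcon G),
       genv = product_move q A (genv G),
       gspec = LG (LF (LDisj (\<lambda>p. LAtom (eq_atom q p)) (bfinal A))) \<rparr>"

end

theory Submission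
  imports Defs "HOL-Library.Infinite_Set" "HOL-Library.Nat_Bijection"
begin

text \<open>The automaton is deterministic and complete, so its state is a function of the finite play
  read so far, and plays of \<open>G\<close> from \<open>s\<close> correspond bijectively to plays of the product from
  \<open>(s, q\<^sub>0)\<close>. By the language hypothesis the play satisfies the specification iff its lift visits
  final states infinitely often, and strategies transfer along the bijection in both directions. A
  memoryless product strategy becomes one whose memory is the automaton state. To represent it, take
  the product of its strategy automaton with the Buechi automaton and substitute the automaton state
  for the variable \<open>q\<close> in all guards.\<close>

section \<open>Constraints\<close>

lemma atom_sat_cong:
  assumes "\<And>x. x \<in> atom_vars a \<Longrightarrow> s x = t x"
  shows "atom_sat s a \<longleftrightarrow> atom_sat t a"
proof (cases a)
  case (Atom ts r c)
  have "(\<Sum>(k, x)\<leftarrow>ts. real_of_int k * s x) = (\<Sum>(k, x)\<leftarrow>ts. real_of_int k * t x)"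
    by (rule arg_cong[where f = sum_list], rule map_cong) (use assms Atom in \<open>force+\<close>)
  then show ?thesis by (simp add: Atom)
qed

lemma sat_cong:
  "(\<And>x. x \<in> constr_vars c \<Longrightarrow> s x = t x) \<Longrightarrow> sat s c \<longleftrightarrow> sat t c"
proof (induction c)
  case (CAtom a)
  then show ?case using atom_sat_cong[of a s t] by simp
qed auto

lemma atom_sat_map: "atom_sat s (map_atom f a) \<longleftrightarrow> atom_sat (s \<circ> f) a"
  by (cases a) (simp add: comp_def case_prod_unfold)

lemma sat_map: "sat s (map_constr f c) \<longleftrightarrow> sat (s \<circ> f) c"
  by (induction c) (simp_all add: atom_sat_map o_def)

lemma set_enum_list: "finite A \<Longrightarrow> set (enum_list A) = A"
  unfolding enum_list_def using someI_ex[OF finite_distinct_list] by blast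

lemma not_atom_sat_false_atom [simp]: "\<not> atom_sat s false_atom"
  by (simp add: false_atom_def)

lemma atom_sat_eq_atom [simp]: "atom_sat s (eq_atom x p) \<longleftrightarrow> s x = real_of_int p"
  by (simp add: eq_atom_def)

lemma sat_CDisj:
  assumes "finite A"
  shows "sat s (CDisj f A) \<longleftrightarrow> (\<exists>a\<in>A. sat s (f a))"
proof -
  have "sat s (foldr (\<lambda>a. COr (f a)) xs (CAtom false_atom)) \<longleftrightarrow> (\<exists>a\<in>set xs. sat s (f a))" for xs
    by (induction xs) auto
  then show ?thesis by (simp add: CDisj_def set_enum_list assms)
qed

lemma ltl_sat_at_LDisj:
  assumes "finite A"
  shows "ltl_sat_at \<rho> i (LDisj f A) \<longleftrightarrow> (\<exists>a\<in>A. ltl_sat_at \<rho> i (f a))"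
proof -
  have "ltl_sat_at \<rho> i (foldr (\<lambda>a. LOr (f a)) xs (LAtom false_atom))
      \<longleftrightarrow> (\<exists>a\<in>set xs. ltl_sat_at \<rho> i (f a))" for xs
    by (induction xs) auto
  then show ?thesis by (simp add: LDisj_def set_enum_list assms)
qed

text \<open>A set of naturals is infinite iff it is unbounded. This turns the objective of the
  product game into Buchi acceptance.\<close>

lemma ltl_sat_LG_LF: "ltl_sat \<rho> (LG (LF \<phi>)) \<longleftrightarrow> infinite {i. ltl_sat_at \<rho> i \<phi>}"
  by (simp add: ltl_sat_def LG_def LF_def infinite_nat_iff_unbounded_le)

text \<open>Substituting an integer for a variable keeps an atom in the integer fragment: the terms in
  that variable move to the right-hand side.\<close>

fun subst_atom :: "'v \<Rightarrow> int \<Rightarrow> 'v atom \<Rightarrow> 'v atom" where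
  "subst_atom q p (Atom ts r c) =
     Atom (filter (\<lambda>(a, x). x \<noteq> q) ts) r (c - (\<Sum>(a, x)\<leftarrow>ts. if x = q then a * p else 0))"

primrec subst_constr :: "'v \<Rightarrow> int \<Rightarrow> 'v constr \<Rightarrow> 'v constr" where
  "subst_constr q p (CAtom a) = CAtom (subst_atom q p a)"
| "subst_constr q p (CNot c) = CNot (subst_constr q p c)"
| "subst_constr q p (CAnd c d) = CAnd (subst_constr q p c) (subst_constr q p d)"
| "subst_constr q p (COr c d) = COr (subst_constr q p c) (subst_constr q p d)"

lemma lrel_holds_add_cancel: "lrel_holds r (x + y) z \<longleftrightarrow> lrel_holds r x (z - y)"
  by (cases r) auto

lemma atom_sat_subst_atom: "atom_sat s (subst_atom q p a) \<longleftrightarrow> atom_sat (s(q := real_of_int p)) a"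
proof (cases a)
  case (Atom ts r c)
  have "(\<Sum>(a, x)\<leftarrow>ts. real_of_int a * (s(q := real_of_int p)) x) =
      (\<Sum>(a, x)\<leftarrow>filter (\<lambda>(a, x). x \<noteq> q) ts. real_of_int a * s x) +
      real_of_int (\<Sum>(a, x)\<leftarrow>ts. if x = q then a * p else 0)"
    by (induction ts) auto
  then show ?thesis by (simp add: Atom lrel_holds_add_cancel del: fun_upd_apply)
qed

lemma sat_subst_constr: "sat s (subst_constr q p c) \<longleftrightarrow> sat (s(q := real_of_int p)) c"
  by (induction c) (simp_all add: atom_sat_subst_atom fun_upd_def)

lemma constr_vars_subst_constr: "constr_vars (subst_constr q p c) \<subseteq> constr_vars c - {q}"
proof (induction c)
  case (CAtom a)
  then show ?case by (cases a) (auto elim!: snds.cases intro: snds.intros)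
qed auto


section \<open>Runs of strategy automata\<close>

text \<open>Runs start in a controller state and transitions alternate between two disjoint sets of
  states, so parity decides the kind of each state. This later bounds the move index
  \<open>samove S (last rs)\<close>.\<close>

lemma strat_aut_run_last_ctrl:
  assumes S: "strat_aut_over V k S" and run: "strat_aut_run S w rs" and "odd (length w)"
  shows "last rs \<in> sactrl S"
proof -
  have tr: "satrans S \<subseteq> (sactrl S \<times> UNIV \<times> saenv S) \<union> (saenv S \<times> UNIV \<times> sactrl S)"
    "sactrl S \<inter> saenv S = {}" "sainit S \<subseteq> sactrl S"
    using S unfolding strat_aut_over_def by blast+
  have len: "length rs = length w" "rs \<noteq> []" "hd rs \<in> sainit S"
    using run by (auto simp: strat_aut_run_def)
  have "rs ! i \<in> (if even i then sactrl S else saenv S)" if "i < length w" for i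
    using that
  proof (induction i)
    case 0
    then show ?case using len tr by (auto simp: hd_conv_nth)
  next
    case (Suc i)
    then have "(rs ! i, w ! i, rs ! Suc i) \<in> step_rel (satrans S)"
      using run by (simp add: strat_aut_run_def)
    then show ?case using Suc tr by (fastforce simp: step_rel_def)
  qed
  \<comment> \<open>The word has odd length, so its last index is even.\<close>
  from this[of "length w - 1"] show ?thesis
    using len assms(3) by (cases "length w") (auto simp: last_conv_nth)
qed


section \<open>The product construction\<close>

locale ltl_product =
  fixes G :: "'v game" and A :: "(int, 'v) buchi" and q :: 'v and q0 :: int
  assumes game: "ltl_game G"
    and aut: "buchi_over (gvars G) A"
    and init: "binit A = {q0}"
    and det: "buchi_deterministic (gvars G) A"
    and compl: "buchi_complete (gvars G) A"
    and lang: "buchi_lang (gvars G) A =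
                 {\<rho>. (\<forall>i. \<rho> i \<in> vstates (gvars G)) \<and> ltl_sat \<rho> (gspec G)}"
    and fresh: "q \<notin> gvars G"
begin

abbreviation "P \<equiv> product_game G q A"

definition emb :: "'v state \<Rightarrow> int \<Rightarrow> 'v state" where
  "emb s p = s(q := real_of_int p)"

text \<open>States are extensional and \<open>q\<close> is fresh, so forgetting \<open>q\<close> means resetting it to
  \<open>undefined\<close>.\<close>

definition proj :: "'v state \<Rightarrow> 'v state" where
  "proj s = s(q := undefined)"

text \<open>The true successor only if \<open>p\<close> is a state of \<open>A\<close> and
  \<open>s\<close> a state over \<open>gvars G\<close>; elsewhere the description operator may give
  an arbitrary value.\<close>

definition nxt :: "int \<Rightarrow> 'v state \<Rightarrow> int" where
  "nxt p s = (THE p'. (p, s, p') \<in> step_rel (btrans A))"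

definition astate :: "'v state list \<Rightarrow> int" where
  "astate w = foldl nxt q0 w"

text \<open>Entry \<open>i\<close> carries the automaton state reached before \<open>w ! i\<close>
  is read. Hence the last entry carries \<open>astate (butlast w)\<close>, and a continuation has to
  carry \<open>astate w\<close>.\<close>

definition lift :: "'v state list \<Rightarrow> 'v state list" where
  "lift w = map (\<lambda>i. emb (w ! i) (astate (take i w))) [0..<length w]"

definition lift_seq :: "(nat \<Rightarrow> 'v state) \<Rightarrow> nat \<Rightarrow> 'v state" where
  "lift_seq \<rho> i = emb (\<rho> i) (astate (map \<rho> [0..<i]))"

section \<open>The automaton state as a function of the finite play\<close>

lemma positions_vstates: "s \<in> positions G \<Longrightarrow> s \<in> vstates (gvars G)"
  by (auto simp: positions_def vstates_def PiE_iff)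

text \<open>Completeness gives a successor and determinism makes it unique, so the concrete relation
  is the graph of \<open>nxt\<close>.\<close>

lemma step_rel_iff:
  assumes "p \<in> bstates A" "s \<in> vstates (gvars G)"
  shows "(p, s, p') \<in> step_rel (btrans A) \<longleftrightarrow> p' = nxt p s"
proof -
  have "\<exists>!p'. (p, s, p') \<in> step_rel (btrans A)"
    using det compl assms unfolding buchi_deterministic_def buchi_complete_def by metis
  from theI'[OF this] this show ?thesis unfolding nxt_def by blast
qed

lemma nxt_bstates:
  assumes "p \<in> bstates A" "s \<in> vstates (gvars G)"
  shows "nxt p s \<in> bstates A"
  using step_rel_iff[OF assms, of "nxt p s"] aut by (auto simp: step_rel_def buchi_over_def)

lemma q0_bstates: "q0 \<in> bstates A"
  using aut init by (auto simp: buchi_over_def)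

lemma astate_bstates: "set w \<subseteq> vstates (gvars G) \<Longrightarrow> astate w \<in> bstates A"
proof (induction w rule: rev_induct)
  case Nil
  then show ?case by (simp add: astate_def q0_bstates)
next
  case (snoc s w)
  then show ?case by (simp add: astate_def nxt_bstates)
qed

lemma astate_Nil [simp]: "astate [] = q0"
  by (simp add: astate_def)

lemma astate_snoc [simp]: "astate (w @ [s]) = nxt (astate w) s"
  by (simp add: astate_def)

lemma astate_take_Suc: "i < length w \<Longrightarrow> astate (take (Suc i) w) = nxt (astate (take i w)) (w ! i)"
  by (simp add: take_Suc_conv_app_nth)

section \<open>Embedding, projection and lifting\<close>

lemma emb_q [simp]: "emb s p q = real_of_int p"
  by (simp add: emb_def)

lemma proj_emb [simp]: "s \<in> vstates (gvars G) \<Longrightarrow> proj (emb s p) = s"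
  using fresh by (auto simp: proj_def emb_def vstates_def PiE_iff extensional_def)

lemma length_lift [simp]: "length (lift w) = length w"
  by (simp add: lift_def)

lemma nth_lift [simp]: "i < length w \<Longrightarrow> lift w ! i = emb (w ! i) (astate (take i w))"
  by (simp add: lift_def)

lemma last_lift:
  assumes "w \<noteq> []"
  shows "last (lift w) = emb (last w) (astate (butlast w))"
proof -
  have "lift w \<noteq> []" using assms by (simp add: lift_def)
  then show ?thesis using assms by (simp add: last_conv_nth butlast_conv_take)
qed

lemma lift_map: "lift (map \<rho> [0..<n]) = map (lift_seq \<rho>) [0..<n]"
  by (rule nth_equalityI) (auto simp: lift_seq_def take_map)

section \<open>Positions and moves of the product game\<close>

lemma emb_position: "s \<in> positions G \<Longrightarrow> p \<in> bstates A \<Longrightarrow> emb s p \<in> positions P"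
  using fresh by (auto simp: positions_def product_game_def emb_def PiE_iff extensional_def)

text \<open>The domain of \<open>q\<close> contains only automaton states, so a product position can
  be handled as a pair; the first component is its projection.\<close>

lemma position_cases:
  assumes "x \<in> positions P"
  obtains s p where "s \<in> positions G" "p \<in> bstates A" "x = emb s p"
proof -
  from assms obtain p where p: "p \<in> bstates A" "x q = real_of_int p"
    by (auto simp: positions_def product_game_def PiE_iff)
  have "y \<noteq> q" if "y \<in> gvars G" for y using that fresh by blast
  then have "proj x \<in> positions G"
    using assms by (auto simp: positions_def product_game_def proj_def PiE_iff extensional_def)
  moreover have "x = emb (proj x) p" by (auto simp: emb_def proj_def p)
  ultimately show thesis using that p by blast
qed

lemma pair_sat_emb:
  assumes "constr_vars c \<subseteq> pvars (gvars G)"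
  shows "pair_sat (emb s p) (emb t p') c \<longleftrightarrow> pair_sat s t c"
  unfolding pair_sat_def
  by (rule sat_cong) (use assms fresh in \<open>auto simp: pvars_def emb_def\<close>)

text \<open>The equations on \<open>q\<close> select the transitions from \<open>p\<close> to
  \<open>p'\<close>, and the guards are evaluated on the current state alone. The disjunction is
  therefore the concrete relation, which is the graph of \<open>nxt\<close>.\<close>

lemma pair_sat_trans_constr:
  assumes "p \<in> bstates A" "s \<in> vstates (gvars G)"
  shows "pair_sat (emb s p) (emb t p') (trans_constr q A) \<longleftrightarrow> p' = nxt p s"
proof -
  have "finite (btrans A)" using aut by (simp add: buchi_over_def)
  \<comment> \<open>Guards range over \<open>gvars G\<close>, so the value stored in the fresh
    \<open>q\<close> cannot affect them.\<close>
  moreover have "sat (emb s p) \<delta> \<longleftrightarrow> sat s \<delta>" if "(p, \<delta>, p') \<in> btrans A" for \<delta>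
    by (rule sat_cong) (use that aut fresh in \<open>auto simp: buchi_over_def emb_def\<close>)
  ultimately have "pair_sat (emb s p) (emb t p') (trans_constr q A)
      \<longleftrightarrow> (p, s, p') \<in> step_rel (btrans A)"
    by (auto simp: pair_sat_def trans_constr_def sat_CDisj sat_map comp_def step_rel_def
        split: prod.splits intro!: bexI)
  then show ?thesis by (simp add: step_rel_iff assms)
qed

lemma pair_sat_product_move:
  assumes "p \<in> bstates A" "s \<in> vstates (gvars G)" "constr_vars c \<subseteq> pvars (gvars G)"
  shows "pair_sat (emb s p) (emb t p') (product_move q A c) \<longleftrightarrow> pair_sat s t c \<and> p' = nxt p s"
  using pair_sat_emb[OF assms(3)] pair_sat_trans_constr[OF assms(1,2)]
  by (simp add: product_move_def pair_sat_def)

lemma pair_sat_gcon: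
  assumes "p \<in> bstates A" "s \<in> vstates (gvars G)"
  shows "pair_sat (emb s p) (emb t p') (gcon P) \<longleftrightarrow> pair_sat s t (gcon G) \<and> p' = nxt p s"
  using pair_sat_product_move[OF assms] game by (simp add: product_game_def ltl_game_def)

lemma legal_product:
  assumes "p \<in> bstates A" "s \<in> vstates (gvars G)"
  shows "legal P i (emb s p) (emb t p') \<longleftrightarrow> legal G i s t \<and> p' = nxt p s"
  using pair_sat_product_move[OF assms] game by (simp add: legal_def product_game_def ltl_game_def)

section \<open>Correspondence of plays\<close>

lemma fin_play_lift:
  assumes "fin_play G w"
  shows "fin_play P (lift w)"
proof -
  have w: "set w \<subseteq> positions G" using assms by (simp add: fin_play_def)
  have vs: "w ! i \<in> positions G" if "i < length w" for i using that w by auto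
  have as: "astate (take i w) \<in> bstates A" for i
    using astate_bstates[of "take i w"] w positions_vstates set_take_subset[of i w] by blast
  have "set (lift w) \<subseteq> positions P"
    using vs as emb_position by (auto simp: lift_def)
  moreover have "legal P i (lift w ! i) (lift w ! Suc i)" if "Suc i < length w" for i
    using that assms vs as positions_vstates
    by (simp add: legal_product astate_take_Suc fin_play_def)
  ultimately show ?thesis using assms by (auto simp: fin_play_def lift_def)
qed

lemma odd_play_lift: "odd_play G w \<Longrightarrow> odd_play P (lift w)"
  by (simp add: odd_play_def fin_play_lift)

lemma legal_proj:
  assumes "x \<in> positions P" "y \<in> positions P" "legal P i x y"
  shows "legal G i (proj x) (proj y)"
  using assms by (elim position_cases) (simp add: legal_product positions_vstates)

lemma proj_position: "x \<in> positions P \<Longrightarrow> proj x \<in> positions G"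
  by (elim position_cases) (simp add: positions_vstates)

lemma odd_play_proj:
  assumes "odd_play P w"
  shows "odd_play G (map proj w)"
  using assms legal_proj
  by (auto simp: odd_play_def fin_play_def subset_iff intro!: proj_position)

lemma play_lift_seq:
  assumes "play G \<rho>"
  shows "play P (lift_seq \<rho>)"
proof -
  have as: "astate (map \<rho> [0..<i]) \<in> bstates A" for i
    using assms positions_vstates by (intro astate_bstates) (auto simp: play_def)
  show ?thesis
    using assms as positions_vstates
    by (auto simp: play_def lift_seq_def legal_product intro!: emb_position)
qed

text \<open>Both players' moves force the value of \<open>q\<close> to follow \<open>nxt\<close>.
  Once it starts at \<open>q0\<close>, the play is determined by its projection.\<close>

lemma play_product_eq_lift_seq:
  assumes "play P \<rho>'" "\<rho>' 0 = emb s q0" "s \<in> positions G"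
  shows "\<rho>' = lift_seq (proj \<circ> \<rho>')"
proof
  fix i
  show "\<rho>' i = lift_seq (proj \<circ> \<rho>') i"
  proof (induction i)
    case 0
    then show ?case using assms positions_vstates by (simp add: lift_seq_def)
  next
    case (Suc i)
    have leg: "legal P i (\<rho>' i) (\<rho>' (Suc i))" and pos: "\<And>j. \<rho>' j \<in> positions P"
      using assms by (auto simp: play_def)
    obtain t p' where t: "t \<in> positions G" "\<rho>' (Suc i) = emb t p'"
      using position_cases[OF pos] by metis
    obtain s p where s: "s \<in> positions G" "p \<in> bstates A" "\<rho>' i = emb s p"
      using position_cases[OF pos] by metis
    \<comment> \<open>Evaluating the induction hypothesis at \<open>q\<close> recovers the automaton
      component, since integers embed injectively into the reals.\<close>
    have "p = astate (map (proj \<circ> \<rho>') [0..<i])"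
      using arg_cong[OF Suc, of "\<lambda>x. x q"] s by (simp add: lift_seq_def o_def)
    moreover have "p' = nxt p s"
      using leg s t positions_vstates by (simp add: legal_product)
    ultimately show ?case using s t positions_vstates by (simp add: lift_seq_def o_def)
  qed
qed

lemma play_proj: "play P \<rho>' \<Longrightarrow> play G (proj \<circ> \<rho>')"
  using legal_proj proj_position by (simp add: play_def)

section \<open>Acceptance and the specification\<close>

text \<open>There is exactly one run on \<rho>, given by \<open>astate\<close> of its prefixes, so
  the existential over runs disappears.\<close>

lemma buchi_accepts_iff:
  assumes "\<And>i. \<rho> i \<in> vstates (gvars G)"
  shows "buchi_accepts A \<rho> \<longleftrightarrow> infinite {i. astate (map \<rho> [0..<i]) \<in> bfinal A}"
proof -
  have as: "astate (map \<rho> [0..<i]) \<in> bstates A" for i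
    using assms by (intro astate_bstates) auto
  have "buchi_run A \<rho> r \<longleftrightarrow> r = (\<lambda>i. astate (map \<rho> [0..<i]))" for r
  proof
    assume r: "buchi_run A \<rho> r"
    show "r = (\<lambda>i. astate (map \<rho> [0..<i]))"
    proof
      fix i show "r i = astate (map \<rho> [0..<i])"
      proof (induction i)
        case 0
        then show ?case using r init by (simp add: buchi_run_def)
      next
        case (Suc i)
        have "(r i, \<rho> i, r (Suc i)) \<in> step_rel (btrans A)" using r by (simp add: buchi_run_def)
        then show ?case using Suc as assms by (simp add: step_rel_iff)
      qed
    qed
  next
    assume "r = (\<lambda>i. astate (map \<rho> [0..<i]))"
    then show "buchi_run A \<rho> r" using as assms init by (simp add: buchi_run_def step_rel_iff)
  qed
  then show ?thesis by (simp add: buchi_accepts_def)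
qed

text \<open>Both sides say that the unique run visits final states infinitely often: the left one by
  the form of the product objective, the right one by the language hypothesis.\<close>

lemma ltl_sat_lift_seq:
  assumes "play G \<rho>"
  shows "ltl_sat (lift_seq \<rho>) (gspec P) \<longleftrightarrow> ltl_sat \<rho> (gspec G)"
proof -
  have vs: "\<rho> i \<in> vstates (gvars G)" for i
    using assms positions_vstates by (simp add: play_def)
  have "finite (bfinal A)" using aut finite_subset by (auto simp: buchi_over_def)
  then have "ltl_sat (lift_seq \<rho>) (gspec P) \<longleftrightarrow>
      infinite {i. astate (map \<rho> [0..<i]) \<in> bfinal A}"
    by (simp add: product_game_def ltl_sat_LG_LF ltl_sat_at_LDisj lift_seq_def)
  also have "\<dots> \<longleftrightarrow> \<rho> \<in> buchi_lang (gvars G) A"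
    using vs by (simp add: buchi_accepts_iff buchi_lang_def)
  also have "\<dots> \<longleftrightarrow> ltl_sat \<rho> (gspec G)" using vs by (simp add: lang)
  finally show ?thesis .
qed

section \<open>Transfer of strategies and winning regions\<close>

text \<open>The automaton component is not chosen by the strategy: legality under
  \<open>gcon P\<close> fixes it.\<close>

definition strat_up :: "'v strat \<Rightarrow> 'v strat" where
  "strat_up \<sigma> w =
     {x \<in> positions P. pair_sat (last w) x (gcon P) \<and> proj x \<in> \<sigma> (map proj w)}"

text \<open>The automaton component of an offered position is \<open>astate w\<close> over the whole
  of \<open>w\<close>, because the last state of \<open>w\<close> has been read by then.\<close>

definition strat_down :: "'v strat \<Rightarrow> 'v strat" where
  "strat_down \<sigma>' w = {t \<in> positions G. emb t (astate w) \<in> \<sigma>' (lift w)}"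

lemma odd_play_last:
  assumes "odd_play H w"
  shows "w \<noteq> []" "last w \<in> positions H"
  using assms by (auto simp: odd_play_def fin_play_def)

text \<open>A product play may start with any automaton state, so its components need not agree with
  \<open>astate\<close>. The witness therefore uses only the component \<open>p\<close> of the last
  position and its successor \<open>nxt p s\<close>.\<close>

lemma strategy_strat_up:
  assumes "strategy G \<sigma>"
  shows "strategy P (strat_up \<sigma>)"
  unfolding strategy_def
proof (intro allI impI conjI)
  fix w assume w: "odd_play P w"
  obtain s p where s: "s \<in> positions G" "p \<in> bstates A" "last w = emb s p"
    using position_cases odd_play_last[OF w] by blast
  have last: "last (map proj w) = s"
    using s odd_play_last[OF w] positions_vstates by (simp add: last_map)
  obtain t where t: "t \<in> \<sigma> (map proj w)" "t \<in> positions G" "pair_sat s t (gcon G)"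
    using assms odd_play_proj[OF w] last unfolding strategy_def by blast
  have "emb t (nxt p s) \<in> strat_up \<sigma> w"
    using s t positions_vstates
    by (auto simp: strat_up_def pair_sat_gcon nxt_bstates intro!: emb_position)
  then show "strat_up \<sigma> w \<noteq> {}" by blast
qed (auto simp: strat_up_def)

text \<open>The projection of a consistent play is consistent with \<sigma>. Since the play starts
  at \<open>q0\<close>, it is the lift of that projection and inherits the verdict on the
  specification.\<close>

lemma winning_from_strat_up:
  assumes s: "s \<in> positions G" and win: "winning_from G \<sigma> s"
  shows "winning_from P (strat_up \<sigma>) (emb s q0)"
  unfolding winning_from_def
proof (intro allI impI, elim conjE)
  fix \<rho>' assume \<rho>': "play P \<rho>'" "\<rho>' 0 = emb s q0" "consistent (strat_up \<sigma>) \<rho>'"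
  have "consistent \<sigma> (proj \<circ> \<rho>')"
    using \<rho>'(3) by (simp add: consistent_def strat_up_def)
  then have "ltl_sat (proj \<circ> \<rho>') (gspec G)"
    using win \<rho>' s play_proj positions_vstates by (simp add: winning_from_def)
  then show "ltl_sat \<rho>' (gspec P)"
    using play_product_eq_lift_seq[OF \<rho>'(1,2) s] ltl_sat_lift_seq[OF play_proj[OF \<rho>'(1)]] by simp
qed

lemma strategy_strat_down:
  assumes "strategy P \<sigma>'"
  shows "strategy G (strat_down \<sigma>')"
  unfolding strategy_def
proof (intro allI impI)
  fix w assume w: "odd_play G w"
  have ne: "w \<noteq> []" and lastv: "last w \<in> vstates (gvars G)"
    using odd_play_last[OF w] positions_vstates by auto
  have "set (butlast w) \<subseteq> vstates (gvars G)"
    using w positions_vstates by (auto simp: odd_play_def fin_play_def dest!: in_set_butlastD)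
  then have as: "astate (butlast w) \<in> bstates A" by (rule astate_bstates)
  have asw: "nxt (astate (butlast w)) (last w) = astate w"
    using ne by (metis append_butlast_last_id astate_snoc)
  have \<sigma>': "\<sigma>' (lift w) \<noteq> {}"
    "\<And>x. x \<in> \<sigma>' (lift w) \<Longrightarrow> x \<in> positions P \<and> pair_sat (last (lift w)) x (gcon P)"
    using assms odd_play_lift[OF w] unfolding strategy_def by blast+
  obtain x where x: "x \<in> \<sigma>' (lift w)" using \<sigma>' by blast
  obtain t p where t: "t \<in> positions G" "x = emb t p" using position_cases \<sigma>'(2)[OF x] by blast
  \<comment> \<open>Legality of the offered product move forces its automaton component, so the
    offered position survives the filter in \<open>strat_down\<close>.\<close>
  then have "p = astate w"
    using \<sigma>'(2)[OF x] as lastv ne asw by (simp add: last_lift pair_sat_gcon)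
  then have "strat_down \<sigma>' w \<noteq> {}" using x t by (auto simp: strat_down_def)
  moreover have "pair_sat (last w) t (gcon G)" if "t \<in> strat_down \<sigma>' w" for t
    using that \<sigma>'(2)[of "emb t (astate w)"] as lastv ne
    by (simp add: strat_down_def last_lift pair_sat_gcon)
  ultimately show "strat_down \<sigma>' w \<noteq> {} \<and>
      strat_down \<sigma>' w \<subseteq> {t \<in> positions G. pair_sat (last w) t (gcon G)}"
    by (auto simp: strat_down_def)
qed

text \<open>Lifting commutes with taking prefixes, so the lift of a consistent play is consistent
  with \<open>\<sigma>'\<close>.\<close>

lemma winning_from_strat_down:
  assumes "winning_from P \<sigma>' (emb s q0)"
  shows "winning_from G (strat_down \<sigma>') s"
  unfolding winning_from_def
proof (intro allI impI, elim conjE)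
  fix \<rho> assume \<rho>: "play G \<rho>" "\<rho> 0 = s" "consistent (strat_down \<sigma>') \<rho>"
  have "consistent \<sigma>' (lift_seq \<rho>)"
    unfolding consistent_def
  proof
    fix i
    have "emb (\<rho> (2 * i + 1)) (astate (map \<rho> [0..<2 * i + 1])) \<in> \<sigma>' (lift (map \<rho> [0..<2 * i + 1]))"
      using \<rho>(3) unfolding consistent_def strat_down_def by blast
    then show "lift_seq \<rho> (2 * i + 1) \<in> \<sigma>' (map (lift_seq \<rho>) [0..<2 * i + 1])"
      unfolding lift_map lift_seq_def .
  qed
  then have "ltl_sat (lift_seq \<rho>) (gspec P)"
    using assms play_lift_seq[OF \<rho>(1)] \<rho>(2) by (simp add: winning_from_def lift_seq_def)
  then show "ltl_sat \<rho> (gspec G)" using ltl_sat_lift_seq[OF \<rho>(1)] by simp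
qed

lemma winning_region_product:
  "winning_region G = {s \<in> positions G. emb s q0 \<in> winning_region P}"
  unfolding winning_region_def
  using strategy_strat_up winning_from_strat_up strategy_strat_down winning_from_strat_down
    emb_position q0_bstates
  by blast

section \<open>Finite memory\<close>

text \<open>The memory is the automaton state before the current position, coded by
  \<open>int_encode\<close> because memory states are naturals.\<close>

lemma finite_memory_strat_down:
  assumes "memoryless P \<sigma>'"
  shows "finite_memory G (strat_down \<sigma>')"
proof -
  define upd where "upd m s = int_encode (nxt (int_decode m) s)" for m s
  \<comment> \<open>By memorylessness, a one-element play ending in the same product position can
    stand for the whole history.\<close>
  define out where
    "out m s = {t \<in> positions G. emb t (nxt (int_decode m) s) \<in> \<sigma>' [emb s (int_decode m)]}" for m s
  have upd: "foldl upd (int_encode q0) w = int_encode (astate w)" for w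
    by (induction w rule: rev_induct) (simp_all add: upd_def)
  have "strat_down \<sigma>' w = out (foldl upd (int_encode q0) (butlast w)) (last w)"
    if w: "odd_play G w" for w
  proof -
    have ne: "w \<noteq> []" using odd_play_last[OF w] by auto
    have last: "last (lift w) = emb (last w) (astate (butlast w))"
      using ne by (rule last_lift)
    \<comment> \<open>A single position is an odd play, so memorylessness applies to it.\<close>
    have "odd_play P [last (lift w)]"
      using odd_play_last[OF odd_play_lift[OF w]] by (simp add: odd_play_def fin_play_def)
    then have "\<sigma>' (lift w) = \<sigma>' [last (lift w)]"
      using assms odd_play_lift[OF w] unfolding memoryless_def by (metis last.simps)
    moreover have "nxt (astate (butlast w)) (last w) = astate w"
      using ne by (metis append_butlast_last_id astate_snoc)
    ultimately show ?thesis by (simp add: strat_down_def out_def upd last)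
  qed
  moreover have "finite (int_encode ` bstates A)" using aut by (simp add: buchi_over_def)
  moreover have "\<forall>m\<in>int_encode ` bstates A. \<forall>s\<in>positions G. upd m s \<in> int_encode ` bstates A"
    using nxt_bstates positions_vstates by (auto simp: upd_def)
  ultimately show ?thesis
    unfolding finite_memory_def using q0_bstates
    by (intro exI[of _ "int_encode ` bstates A"] exI[of _ "int_encode q0"] exI[of _ upd]
        exI[of _ out]) auto
qed

section \<open>The strategy automaton for the original game\<close>

text \<open>\<open>finitely_representable\<close> asks for natural numbers as states, so pairs of a
  strategy state and an automaton state are coded injectively.\<close>

definition enc :: "nat \<times> int \<Rightarrow> nat" where
  "enc = (\<lambda>(r, p). prod_encode (r, int_encode p))"

definition dec :: "nat \<Rightarrow> nat \<times> int" where
  "dec n = map_prod id int_decode (prod_decode n)"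

lemma dec_enc [simp]: "dec (enc x) = x"
  by (cases x) (simp add: dec_def enc_def)

lemma enc_eq_iff [simp]: "enc x = enc y \<longleftrightarrow> x = y"
  by (metis dec_enc)

text \<open>The synchronous product of \<open>S\<close> with \<open>A\<close>. As the second
  component records the value of \<open>q\<close>, that value is substituted in each guard and label
  of \<open>S\<close>, which leaves constraints over \<open>gvars G\<close>.\<close>

definition aut_down :: "(nat, 'v) strat_aut \<Rightarrow> (nat, 'v) strat_aut" where
  "aut_down S =
     \<lparr> sactrl = enc ` (sactrl S \<times> bstates A),
       saenv = enc ` (saenv S \<times> bstates A),
       sainit = enc ` (sainit S \<times> {q0}),
       satrans = (\<lambda>((r, \<delta>, r'), (p, \<gamma>, p')). (enc (r, p), CAnd (subst_constr q p \<delta>) \<gamma>, enc (r', p')))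
                   ` (satrans S \<times> btrans A),
       sacond = (\<lambda>n. subst_constr q (snd (dec n)) (sacond S (fst (dec n)))),
       samove = (\<lambda>n. samove S (fst (dec n))) \<rparr>"

lemma strat_aut_over_aut_down:
  assumes "strat_aut_over (insert q (gvars G)) k S"
  shows "strat_aut_over (gvars G) k (aut_down S)"
proof -
  have sub: "constr_vars (subst_constr q p c) \<subseteq> gvars G"
    if "constr_vars c \<subseteq> insert q (gvars G)" for p c
    using constr_vars_subst_constr[of q p c] that by blast
  have S: "satrans S \<subseteq> (sactrl S \<times> {\<delta>. constr_vars \<delta> \<subseteq> insert q (gvars G)} \<times> saenv S) \<union>
      (saenv S \<times> {\<delta>. constr_vars \<delta> \<subseteq> insert q (gvars G)} \<times> sactrl S)"
    using assms by (simp add: strat_aut_over_def)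
  have T: "btrans A \<subseteq> bstates A \<times> {\<delta>. constr_vars \<delta> \<subseteq> gvars G} \<times> bstates A"
    using aut by (simp add: buchi_over_def)
  have "satrans (aut_down S) \<subseteq>
      (sactrl (aut_down S) \<times> {\<delta>. constr_vars \<delta> \<subseteq> gvars G} \<times> saenv (aut_down S)) \<union>
      (saenv (aut_down S) \<times> {\<delta>. constr_vars \<delta> \<subseteq> gvars G} \<times> sactrl (aut_down S))" (is "_ \<subseteq> ?T")
  proof
    fix x assume "x \<in> satrans (aut_down S)"
    then obtain r \<delta> r' p \<gamma> p' where x: "(r, \<delta>, r') \<in> satrans S" "(p, \<gamma>, p') \<in> btrans A"
      "x = (enc (r, p), CAnd (subst_constr q p \<delta>) \<gamma>, enc (r', p'))"
      by (auto simp: aut_down_def)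
    have "constr_vars \<delta> \<subseteq> insert q (gvars G)" using x(1) S by blast
    from sub[OF this, of p] show "x \<in> ?T"
      using x subsetD[OF S x(1)] subsetD[OF T x(2)] by (auto simp: aut_down_def)
  qed
  moreover have "finite (bstates A)" "finite (btrans A)" using aut by (auto simp: buchi_over_def)
  ultimately show ?thesis
    using assms q0_bstates sub by (auto simp: strat_aut_over_def aut_down_def)
qed

text \<open>A substituted guard holds at \<open>s\<close> iff the original holds at
  \<open>emb s p\<close>; the other conjunct is a guard of \<open>A\<close>, which determines the
  second component.\<close>

lemma step_rel_aut_down:
  assumes "p \<in> bstates A" "s \<in> vstates (gvars G)"
  shows "(enc (r, p), s, n) \<in> step_rel (satrans (aut_down S)) \<longleftrightarrow>
      (\<exists>r'. n = enc (r', nxt p s) \<and> (r, emb s p, r') \<in> step_rel (satrans S))"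
proof -
  have "(enc (r, p), s, n) \<in> step_rel (satrans (aut_down S)) \<longleftrightarrow>
      (\<exists>r' p'. n = enc (r', p') \<and> (r, emb s p, r') \<in> step_rel (satrans S) \<and>
         (p, s, p') \<in> step_rel (btrans A))"
    by (force simp: step_rel_def aut_down_def sat_subst_constr emb_def image_iff)
  then show ?thesis using step_rel_iff[OF assms] by auto
qed

text \<open>The second component starts at \<open>q0\<close> and must follow \<open>nxt\<close>, so
  it equals \<open>astate\<close> of the prefix read. The first component is then a run of
  \<open>S\<close> on the lifted play.\<close>

lemma strat_aut_run_aut_down:
  assumes w: "set w \<subseteq> vstates (gvars G)"
  shows "strat_aut_run (aut_down S) w ns \<longleftrightarrow>
    (\<exists>rs. strat_aut_run S (lift w) rs \<and>
       ns = map (\<lambda>i. enc (rs ! i, astate (take i w))) [0..<length w])"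
    (is "?L \<longleftrightarrow> ?R")
proof -
  have wi: "w ! i \<in> vstates (gvars G)" if "i < length w" for i using that w by auto
  have as: "astate (take i w) \<in> bstates A" for i
    using astate_bstates[of "take i w"] w set_take_subset[of i w] by blast
  show ?thesis
  proof
    assume ns: ?L
    have len: "length ns = length w" "ns \<noteq> []" using ns by (auto simp: strat_aut_run_def)
    have step: "(ns ! i, w ! i, ns ! Suc i) \<in> step_rel (satrans (aut_down S))"
      if "Suc i < length w" for i using ns that by (simp add: strat_aut_run_def)
    have init: "ns ! 0 \<in> enc ` (sainit S \<times> {q0})"
      using ns len by (simp add: strat_aut_run_def aut_down_def hd_conv_nth)
    \<comment> \<open>Decoding and dropping the automaton component leaves the candidate run of
      \<open>S\<close>.\<close>
    define rs where "rs = map (fst \<circ> dec) ns"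
    have nsi: "ns ! i = enc (rs ! i, astate (take i w))" if "i < length w" for i
      using that
    proof (induction i)
      case 0
      then show ?case using init len by (auto simp: rs_def)
    next
      case (Suc i)
      then have "(enc (rs ! i, astate (take i w)), w ! i, ns ! Suc i) \<in> step_rel (satrans (aut_down S))"
        using step[of i] by simp
      then show ?case
        using Suc.prems len by (auto simp: step_rel_aut_down as wi rs_def astate_take_Suc)
    qed
    have "(rs ! i, lift w ! i, rs ! Suc i) \<in> step_rel (satrans S)" if "Suc i < length w" for i
      using step[OF that] that nsi[of i] nsi[of "Suc i"] by (auto simp: step_rel_aut_down as wi)
    moreover have "sat (lift w ! i) (sacond S (rs ! i))" if "i < length w" "even i" for i
    proof -
      have "sat (w ! i) (sacond (aut_down S) (ns ! i))"
        using ns that by (simp add: strat_aut_run_def)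
      then show ?thesis using that nsi[of i] by (simp add: aut_down_def sat_subst_constr emb_def)
    qed
    moreover have "hd rs \<in> sainit S" using init len by (auto simp: rs_def hd_map hd_conv_nth[of ns])
    ultimately have "strat_aut_run S (lift w) rs"
      using len by (simp add: strat_aut_run_def rs_def)
    moreover have "ns = map (\<lambda>i. enc (rs ! i, astate (take i w))) [0..<length w]"
      using len nsi by (intro nth_equalityI) auto
    ultimately show ?R by blast
  next
    assume ?R
    then obtain rs where rs: "strat_aut_run S (lift w) rs"
      and ns: "ns = map (\<lambda>i. enc (rs ! i, astate (take i w))) [0..<length w]" by blast
    have len: "length rs = length w" "w \<noteq> []" using rs by (auto simp: strat_aut_run_def)
    have "hd ns = enc (hd rs, q0)"
      using len rs by (simp add: ns hd_map hd_conv_nth strat_aut_run_def)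
    then have "hd ns \<in> sainit (aut_down S)"
      using rs by (simp add: strat_aut_run_def aut_down_def)
    moreover have "(ns ! i, w ! i, ns ! Suc i) \<in> step_rel (satrans (aut_down S))"
      if "Suc i < length w" for i
      using that rs by (simp add: ns strat_aut_run_def step_rel_aut_down as wi astate_take_Suc)
    moreover have "sat (w ! i) (sacond (aut_down S) (ns ! i))" if "i < length w" "even i" for i
      using that rs by (simp add: ns strat_aut_run_def aut_down_def sat_subst_constr emb_def)
    ultimately show ?L using len by (simp add: strat_aut_run_def ns)
  qed
qed

text \<open>Runs correspond, with equal move indices at their ends. A product move into
  \<open>emb t (astate w)\<close> is the original move into \<open>t\<close>, as its condition on
  \<open>q\<close> holds automatically.\<close>

lemma strat_aut_strategy_aut_down:
  assumes S: "strat_aut_over (insert q (gvars G)) (length cs) S"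
    and cs: "\<forall>c\<in>set cs. constr_vars c \<subseteq> pvars (gvars G)"
    and w: "odd_play G w"
  shows "strat_aut_strategy G cs (aut_down S) w =
    strat_down (strat_aut_strategy P (map (product_move q A) cs) S) w"
proof -
  have ne: "w \<noteq> []" and odd: "odd (length w)" and lastv: "last w \<in> vstates (gvars G)"
    using w odd_play_last[OF w] positions_vstates by (auto simp: odd_play_def)
  have wv: "set w \<subseteq> vstates (gvars G)"
    using w positions_vstates by (auto simp: odd_play_def fin_play_def)
  then have as: "astate (butlast w) \<in> bstates A" "astate w \<in> bstates A"
    by (auto intro!: astate_bstates dest!: in_set_butlastD)
  have asw: "nxt (astate (butlast w)) (last w) = astate w"
    using ne by (metis append_butlast_last_id astate_snoc)
  have move: "samove (aut_down S) (last (map (\<lambda>i. enc (rs ! i, astate (take i w))) [0..<length w]))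
      = samove S (last rs)" if "strat_aut_run S (lift w) rs" for rs
    using that ne by (simp add: aut_down_def last_map last_conv_nth[of rs] strat_aut_run_def)
  have pair: "pair_sat (last (lift w)) (emb t (astate w)) (map (product_move q A) cs ! samove S (last rs))
      \<longleftrightarrow> pair_sat (last w) t (cs ! samove S (last rs))" if "strat_aut_run S (lift w) rs" for rs t
  proof -
    \<comment> \<open>Only controller states have a move index known to be below
      \<open>length cs\<close>, which is what indexing into the mapped list requires.\<close>
    have "last rs \<in> sactrl S" using strat_aut_run_last_ctrl[OF S that] odd by simp
    then have "samove S (last rs) < length cs" using S by (simp add: strat_aut_over_def)
    then show ?thesis
      using cs as lastv asw ne by (simp add: last_lift pair_sat_product_move)
  qed
  show ?thesis
    unfolding strat_down_def strat_aut_strategy_def strat_aut_run_aut_down[OF wv]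
    by (auto simp: move pair as emb_position)
qed

lemma finitely_representable_strat_down:
  assumes cs: "fin_nondet G cs"
    and "finitely_representable P (map (product_move q A) cs) \<sigma>'"
  shows "finitely_representable G cs (strat_down \<sigma>')"
proof -
  have "gvars P = insert q (gvars G)" by (simp add: product_game_def)
  then obtain S :: "(nat, 'v) strat_aut" where S: "strat_aut_over (insert q (gvars G)) (length cs) S"
    and \<sigma>': "\<And>w. odd_play P w \<Longrightarrow> \<sigma>' w = strat_aut_strategy P (map (product_move q A) cs) S w"
    using assms(2) unfolding finitely_representable_def by auto
  have "strat_down \<sigma>' w = strat_aut_strategy G cs (aut_down S) w" if "odd_play G w" for w
    using strat_aut_strategy_aut_down[OF S _ that] cs \<sigma>'[OF odd_play_lift[OF that]]
    by (simp add: fin_nondet_def strat_down_def)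
  then show ?thesis
    unfolding finitely_representable_def using strat_aut_over_aut_down[OF S] by blast
qed

end

theorem theorem1:
  fixes G :: "'v game" and A :: "(int, 'v) buchi" and q :: 'v and q0 :: int
  assumes game: "ltl_game G"
    and aut: "buchi_over (gvars G) A"
    and init: "binit A = {q0}"
    and det: "buchi_deterministic (gvars G) A"
    and compl: "buchi_complete (gvars G) A"
    and lang: "buchi_lang (gvars G) A =
                 {\<rho>. (\<forall>i. \<rho> i \<in> vstates (gvars G)) \<and> ltl_sat \<rho> (gspec G)}"
    and fresh: "q \<notin> gvars G"
  shows "winning_region G =
           {s \<in> positions G. s(q := real_of_int q0) \<in> winning_region (product_game G q A)} \<and>
         (\<forall>cs \<sigma>'.
            fin_nondet G cs \<and>
            strategy (product_game G q A) \<sigma>' \<and>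
            memoryless (product_game G q A) \<sigma>' \<and>
            finitely_representable (product_game G q A) (map (product_move q A) cs) \<sigma>' \<longrightarrow>
            (\<exists>\<sigma>. strategy G \<sigma> \<and> finite_memory G \<sigma> \<and> finitely_representable G cs \<sigma> \<and>
               (\<forall>s\<in>positions G.
                  winning_from (product_game G q A) \<sigma>' (s(q := real_of_int q0)) \<longrightarrow>
                  winning_from G \<sigma> s)))"
proof -
  interpret ltl_product G A q q0
    using assms by unfold_locales
  show ?thesis
    using winning_region_product strategy_strat_down finite_memory_strat_down
      finitely_representable_strat_down winning_from_strat_down
    unfolding emb_def by blast
qed

end
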